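(* Fix a noise variance $\sigma^2>0$. There is a constant $C'>0$ (fixed, i.e. not depending on $n,p,s,\beta^*$) such that the following holds. Let $(p,s)=(p_n,s_n)$ be a sequence of integers with $1\le s_n\le p_n$, and let $\mathcal{M}=\mathcal{M}_n>0$ be a sequence of minimum values (so $\mathcal{M}(\beta^* )=\mathcal{M}_n$). If $$ n \;<\; \left[\frac{C'}{s\,\mathcal{M}^2(\beta^* )}\right]\, s\log\frac{p}{s}, $$ then asymptotically reliable recovery is impossible.
   Context: Observation model: for each $n$, a vector $\beta^*\in\mathbb{R}^{p}$ has support $S=\{i\in\{1,\dots,p\}:\beta^*_i\neq 0\}$ of size $|S|=s$, and minimum value $\mathcal{M}(\beta^* )=\min_{i\in S}|\beta^*_i|$. One observes $Y=X\beta^*+W\in\mathbb{R}^n$, where $X\in\mathbb{R}^{n\times p}$ has i.i.d. rows drawn from $N(0,I_{p\times p})$ (standard Gaussian measurement ensemble) and $W\sim N(0,\sigma^2 I_{n\times n})$ is independent of $X$. All of $p$, $s$, $\mathcal{M}$ may vary with $n$, with arbitrary scaling. The support $S$ is chosen uniformly among the $\binom{p}{s}$ subsets of $\{1,\dots,p\}$ of size $s$. Given $S$, the entries $\beta^*_S$ are nonzero and have minimum absolute value exactly $\mathcal{M}_n$; they may be deterministic or drawn from some law depending on $S$, independently of $(X,W)$. Call any such specification of the entries (for all $S$ of size $s$) admissible. A decoder is a (measurable) map $\phi$ sending the observation vector $Y$, with the measurement matrix $X$ and the parameters $(n,p,s)$ known, to an estimated subset $\widehat S=\phi(Y)\subseteq\{1,\dots,p\}$.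 No restriction is made on its computational complexity. Its average error probability is $$p_{\rm err}(\phi)=\frac{1}{\binom{p}{s}}\sum_{S:\,|S|=s}\mathbb{P}[\phi(Y)\neq S\mid S],$$ where the conditional probability averages over $W$, $X$ and the entries $\beta^*_S$. Asymptotically reliable recovery is possible if there is a sequence of decoders $\phi_n$ such that, for every sequence of admissible specifications of the entries, $p_{\rm err}(\phi_n)\to 0$ as $n\to+\infty$; otherwise it is impossible. *)

theory Defs
  imports "HOL-Probability.Probability"
begin

text \<open>
  Since the dimensions vary with the sample size, a vector in $R^d$ is a function on
  \<open>{1..d}\<close>, extended by \<open>undefined\<close> outside, i.e. a point of the product space
  \<open>PiM {1..d} (\<lambda>_. borel)\<close>; an \<open>n \<times> p\<close> matrix is an \<open>n\<close>-tuple of such rows.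
\<close>

definition vec_space :: "nat \<Rightarrow> (nat \<Rightarrow> real) measure" where
  "vec_space d = PiM {1..d} (\<lambda>_. borel)"

definition mat_space :: "nat \<Rightarrow> nat \<Rightarrow> (nat \<Rightarrow> nat \<Rightarrow> real) measure" where
  "mat_space n p = PiM {1..n} (\<lambda>_. vec_space p)"

text \<open>
  The law $N(0, \sigma^2 I)$ on $R^d$. As in \<open>normal_density\<close>, the parameter \<open>\<sigma>\<close> is the
  standard deviation, not the variance.
\<close>

definition gauss_vec :: "nat \<Rightarrow> real \<Rightarrow> (nat \<Rightarrow> real) measure" where
  "gauss_vec d \<sigma> = PiM {1..d} (\<lambda>_. density lborel (normal_density 0 \<sigma>))"

definition gauss_ensemble :: "nat \<Rightarrow> nat \<Rightarrow> (nat \<Rightarrow> nat \<Rightarrow> real) measure" where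
  "gauss_ensemble n p = PiM {1..n} (\<lambda>_. gauss_vec p 1)"

definition observe ::
  "nat \<Rightarrow> nat \<Rightarrow> (nat \<Rightarrow> nat \<Rightarrow> real) \<Rightarrow> (nat \<Rightarrow> real) \<Rightarrow> (nat \<Rightarrow> real) \<Rightarrow> (nat \<Rightarrow> real)" where
  "observe n p X \<beta> W = (\<lambda>i\<in>{1..n}. (\<Sum>j\<in>{1..p}. X i j * \<beta> j) + W i)"

definition supp :: "nat \<Rightarrow> (nat \<Rightarrow> real) \<Rightarrow> nat set" where
  "supp p \<beta> = {i \<in> {1..p}. \<beta> i \<noteq> 0}"

definition min_value :: "nat \<Rightarrow> (nat \<Rightarrow> real) \<Rightarrow> real" where
  "min_value p \<beta> = Min ((\<lambda>i. \<bar>\<beta> i\<bar>) ` supp p \<beta>)"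

definition supports :: "nat \<Rightarrow> nat \<Rightarrow> nat set set" where
  "supports p s = {S. S \<subseteq> {1..p} \<and> card S = s}"

text \<open>
  A specification of the entries assigns to each support \<open>S\<close> the conditional law \<open>Q S\<close> of the
  whole vector \<open>\<beta>\<close> given \<open>S\<close>; deterministic entries correspond to point masses.
\<close>

definition admissible ::
  "nat \<Rightarrow> nat \<Rightarrow> real \<Rightarrow> (nat set \<Rightarrow> (nat \<Rightarrow> real) measure) \<Rightarrow> bool" where
  "admissible p s m Q \<longleftrightarrow>
     (\<forall>S\<in>supports p s. prob_space (Q S) \<and> sets (Q S) = sets (vec_space p) \<and>
        (AE \<beta> in Q S. supp p \<beta> = S \<and> min_value p \<beta> = m))"

definition decoder ::
  "nat \<Rightarrow> nat \<Rightarrow> ((nat \<Rightarrow> nat \<Rightarrow> real) \<Rightarrow> (nat \<Rightarrow> real) \<Rightarrow> nat set) \<Rightarrow> bool" where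
  "decoder n p \<phi> \<longleftrightarrow>
     (\<lambda>(X, Y). \<phi> X Y) \<in> mat_space n p \<Otimes>\<^sub>M vec_space n \<rightarrow>\<^sub>M count_space (Pow {1..p})"

text \<open>
  The joint law of $(\beta, X, W)$ given \<open>S\<close> is a product measure: the entries, the measurement
  matrix and the noise are independent.
\<close>

definition joint_law ::
  "real \<Rightarrow> nat \<Rightarrow> nat \<Rightarrow> (nat \<Rightarrow> real) measure
    \<Rightarrow> ((nat \<Rightarrow> real) \<times> (nat \<Rightarrow> nat \<Rightarrow> real) \<times> (nat \<Rightarrow> real)) measure" where
  "joint_law \<sigma> n p B = B \<Otimes>\<^sub>M (gauss_ensemble n p \<Otimes>\<^sub>M gauss_vec n \<sigma>)"

definition cond_error ::
  "real \<Rightarrow> nat \<Rightarrow> nat \<Rightarrow> ((nat \<Rightarrow> nat \<Rightarrow> real) \<Rightarrow> (nat \<Rightarrow> real) \<Rightarrow> nat set)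
    \<Rightarrow> (nat set \<Rightarrow> (nat \<Rightarrow> real) measure) \<Rightarrow> nat set \<Rightarrow> real" where
  "cond_error \<sigma> n p \<phi> Q S =
     measure (joint_law \<sigma> n p (Q S))
       {(\<beta>, X, W) \<in> space (joint_law \<sigma> n p (Q S)). \<phi> X (observe n p X \<beta> W) \<noteq> S}"

definition p_err ::
  "real \<Rightarrow> nat \<Rightarrow> nat \<Rightarrow> nat \<Rightarrow> ((nat \<Rightarrow> nat \<Rightarrow> real) \<Rightarrow> (nat \<Rightarrow> real) \<Rightarrow> nat set)
    \<Rightarrow> (nat set \<Rightarrow> (nat \<Rightarrow> real) measure) \<Rightarrow> real" where
  "p_err \<sigma> n p s \<phi> Q =
     1 / real (p choose s) * (\<Sum>S\<in>supports p s. cond_error \<sigma> n p \<phi> Q S)"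

definition reliable_recovery_possible ::
  "real \<Rightarrow> (nat \<Rightarrow> nat) \<Rightarrow> (nat \<Rightarrow> nat) \<Rightarrow> (nat \<Rightarrow> real) \<Rightarrow> bool" where
  "reliable_recovery_possible \<sigma> p s m \<longleftrightarrow>
     (\<exists>\<phi>. (\<forall>n\<ge>1. decoder n (p n) (\<phi> n)) \<and>
        (\<forall>Q. (\<forall>n\<ge>1. admissible (p n) (s n) (m n) (Q n)) \<longrightarrow>
           (\<lambda>n. p_err \<sigma> n (p n) (s n) (\<phi> n) (Q n)) \<longlonglongrightarrow> 0))"

end

theory Submission
  imports Defs
begin

text \<open>
  Reliable recovery must succeed for every admissible law of the entries, so it is enough to defeat
  a given decoder with one law: all nonzero entries equal to \<open>m\<close>, that is $\beta = m 1_S$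
  (\<open>flat_signal\<close>).

  The hard part of the problem is to tell which single index was added to a set known in advance. A
  uniform support of size $s$ is a uniform $T$ of size $s - 1$ together with an index $j$ that is
  uniform among the $N = p - s + 1$ remaining ones. Even if $T$ were revealed, the decoder would
  have to locate $j$, and passing from the signal on $T$ to the signal on $T \cup \{j\}$
  merely translates the noise by the vector $v = m X_j$, whose expected squared length is $n m^2$.
  Since $p / s \le N$, the hypothesis on $n$ says that this is a small multiple of
  $\sigma^2 \log N$.

  A Gaussian noise vector cannot reveal such a translation among $N$ candidates. Let $L$ be the
  likelihood ratio of $N(v, \sigma^2 I)$ to $N(0, \sigma^2 I)$. Its second moment under the
  centred law is $\exp(|v|^2 / \sigma^2)$, and $L 1_A \le (c 1_A + L^2 / c) / 2$ for every
  $c > 0$. Hence the probability of an event after the translation is at most $c / 2$ times its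
  probability before, plus $\exp(|v|^2 / \sigma^2) / (2 c)$
  (\<open>emeasure_gauss_vec_shift_le\<close>). Averaging over the design matrix, with Markov's
  inequality on the event $|v|^2 > K$, gives \<open>decodes_to_flat_signal_insert_le\<close>.

  For a fixed $T$ the events "the decoder answers $T \cup \{j\}$" are disjoint, so under the
  signal on $T$ their probabilities add up to at most $1$. Summing the comparison over all pairs
  $(T, j)$ bounds the average success probability by
  $c / (2 N) + \exp(K / \sigma^2) / (2 c) + n m^2 / K$ (\<open>p_err_flat_signal_ge\<close>). With
  $c = \sqrt N$ and $K = \sigma^2 (\log N) / 4$ the first two terms are at most
  $N^{-1/4} \le 2^{-1/4} < 0.85$, and with $C' = \sigma^2 / 40$ the last one is at most $0.1$. So
  the error probability is at least $1/20$ at every such $n$. Unlike an entropy bound of Fano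
  type, this argument stays informative when $N = 2$.
\<close>

section \<open>Translating a Gaussian variable\<close>

text \<open>The density of $N(v, \sigma^2)$ with respect to $N(0, \sigma^2)$.\<close>

definition shift_lr :: "real \<Rightarrow> real \<Rightarrow> real \<Rightarrow> real" where
  "shift_lr \<sigma> v x = exp ((v * x - v\<^sup>2 / 2) / \<sigma>\<^sup>2)"

lemma measurable_shift_lr[measurable]: "shift_lr \<sigma> v \<in> borel_measurable borel"
  unfolding shift_lr_def[abs_def] by measurable

lemma shift_lr_nonneg[simp]: "0 \<le> shift_lr \<sigma> v x"
  by (simp add: shift_lr_def)

lemma normal_density_shift_lr:
  assumes "\<sigma> > 0"
  shows "normal_density 0 \<sigma> x * shift_lr \<sigma> v x = normal_density v \<sigma> x"
proof -
  have "- (x\<^sup>2 / (2 * \<sigma>\<^sup>2)) + (v * x - v\<^sup>2 / 2) / \<sigma>\<^sup>2 = - ((x - v)\<^sup>2 / (2 * \<sigma>\<^sup>2))"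
    using assms by (simp add: field_simps power2_eq_square)
  then show ?thesis
    by (simp add: normal_density_def shift_lr_def exp_add[symmetric])
qed

text \<open>
  Squaring the likelihood ratio of a translation by \<open>v\<close> gives a multiple of the one for
  \<open>2 * v\<close>. Since a normal density has total mass one, that multiple is the second moment.
\<close>
lemma normal_density_shift_lr_sq:
  assumes "\<sigma> > 0"
  shows "normal_density 0 \<sigma> x * (shift_lr \<sigma> v x)\<^sup>2 = exp (v\<^sup>2 / \<sigma>\<^sup>2) * normal_density (2 * v) \<sigma> x"
proof -
  have "(shift_lr \<sigma> v x)\<^sup>2 = exp (v\<^sup>2 / \<sigma>\<^sup>2) * shift_lr \<sigma> (2 * v) x"
    using assms
    by (simp add: shift_lr_def exp_add[symmetric] power2_eq_square field_simps)
  then show ?thesis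
    using normal_density_shift_lr[OF assms, of x "2 * v"] by (simp add: mult_ac)
qed

lemma distr_normal_shift:
  assumes "\<sigma> > 0"
  shows "distr (density lborel (normal_density 0 \<sigma>)) borel (\<lambda>x. v + x) =
         density (density lborel (normal_density 0 \<sigma>)) (shift_lr \<sigma> v)"
proof (rule measure_eqI)
  fix A :: "real set" assume "A \<in> sets (distr (density lborel (normal_density 0 \<sigma>)) borel (\<lambda>x. v + x))"
  then have [measurable]: "A \<in> sets borel" by simp
  have "emeasure (distr (density lborel (normal_density 0 \<sigma>)) borel (\<lambda>x. v + x)) A =
      (\<integral>\<^sup>+x. ennreal (normal_density 0 \<sigma> x) * indicator A (v + x) \<partial>lborel)"
    by (subst emeasure_distr, simp, simp, subst emeasure_density)
       (auto intro!: nn_integral_cong measurable_sets_borel[of _ borel] split: split_indicator)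
  also have "\<dots> = (\<integral>\<^sup>+x. ennreal (normal_density v \<sigma> x) * indicator A x \<partial>lborel)"
    by (subst nn_integral_real_affine[where c=1 and t=v], simp, simp)
       (auto intro!: nn_integral_cong simp: normal_density_def)
  also have "\<dots> = emeasure (density (density lborel (normal_density 0 \<sigma>)) (shift_lr \<sigma> v)) A"
    by (subst density_density_eq)
       (auto simp: emeasure_density normal_density_shift_lr[OF assms] ennreal_mult[symmetric]
             intro!: nn_integral_cong)
  finally show "emeasure (distr (density lborel (normal_density 0 \<sigma>)) borel (\<lambda>x. v + x)) A =
    emeasure (density (density lborel (normal_density 0 \<sigma>)) (shift_lr \<sigma> v)) A" .
qed simp

lemma nn_integral_shift_lr_sq:
  assumes "\<sigma> > 0"
  shows "(\<integral>\<^sup>+x. ennreal ((shift_lr \<sigma> v x)\<^sup>2) \<partial>density lborel (normal_density 0 \<sigma>)) =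
    ennreal (exp (v\<^sup>2 / \<sigma>\<^sup>2))"
proof -
  have "(\<integral>\<^sup>+x. ennreal ((shift_lr \<sigma> v x)\<^sup>2) \<partial>density lborel (normal_density 0 \<sigma>)) =
    (\<integral>\<^sup>+x. ennreal (exp (v\<^sup>2 / \<sigma>\<^sup>2)) * ennreal (normal_density (2 * v) \<sigma> x) \<partial>lborel)"
    by (subst nn_integral_density)
       (auto intro!: nn_integral_cong
             simp: ennreal_mult[symmetric] normal_density_shift_lr_sq[OF assms])
  also have "\<dots> = ennreal (exp (v\<^sup>2 / \<sigma>\<^sup>2))"
    using assms by (subst nn_integral_cmult) (auto simp: nn_integral_eq_integral)
  finally show ?thesis .
qed

lemma nn_integral_std_normal_sq:
  "(\<integral>\<^sup>+x. ennreal (x\<^sup>2) \<partial>density lborel (normal_density 0 1)) = 1"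
proof -
  have "(\<integral>\<^sup>+x. ennreal (x\<^sup>2) \<partial>density lborel (normal_density 0 1)) =
    (\<integral>\<^sup>+x. ennreal (normal_density 0 1 x * x\<^sup>2) \<partial>lborel)"
    by (subst nn_integral_density) (auto intro!: nn_integral_cong simp: ennreal_mult[symmetric])
  also have "\<dots> = ennreal (\<integral>x. normal_density 0 1 x * x\<^sup>2 \<partial>lborel)"
    by (rule nn_integral_eq_integral[OF integrable_std_normal_moment]) simp
  also have "\<dots> = 1"
    using integral_std_normal_moment_even[of 1] by simp
  finally show ?thesis .
qed

section \<open>The Gaussian design and noise\<close>

lemma prob_space_gauss_vec: "\<sigma> > 0 \<Longrightarrow> prob_space (gauss_vec d \<sigma>)"
  unfolding gauss_vec_def by (intro prob_space_PiM prob_space_normal_density)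

lemma sets_gauss_vec[measurable_cong]: "sets (gauss_vec d \<sigma>) = sets (vec_space d)"
  unfolding gauss_vec_def vec_space_def by (intro sets_PiM_cong) auto

lemma prob_space_gauss_ensemble: "prob_space (gauss_ensemble n p)"
  unfolding gauss_ensemble_def by (intro prob_space_PiM prob_space_gauss_vec) simp

lemma sets_gauss_ensemble[measurable_cong]: "sets (gauss_ensemble n p) = sets (mat_space n p)"
  unfolding gauss_ensemble_def mat_space_def by (intro sets_PiM_cong sets_gauss_vec) auto

lemma measurable_vec_component: "i \<in> {1..d} \<Longrightarrow> (\<lambda>x. x i) \<in> vec_space d \<rightarrow>\<^sub>M borel"
  unfolding vec_space_def by (rule measurable_component_singleton)

lemma measurable_mat_component:
  "i \<in> {1..n} \<Longrightarrow> j \<in> {1..p} \<Longrightarrow> (\<lambda>X. X i j) \<in> mat_space n p \<rightarrow>\<^sub>M borel"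
  unfolding mat_space_def
  by (rule measurable_compose[OF measurable_component_singleton], assumption)
     (rule measurable_vec_component)

lemma measurable_observe:
  "(\<lambda>(\<beta>, X, W). observe n p X \<beta> W) \<in> vec_space p \<Otimes>\<^sub>M (mat_space n p \<Otimes>\<^sub>M vec_space n) \<rightarrow>\<^sub>M vec_space n"
proof -
  have "(\<lambda>(\<beta>, X, W). observe n p X \<beta> W) \<in>
    vec_space p \<Otimes>\<^sub>M (mat_space n p \<Otimes>\<^sub>M vec_space n) \<rightarrow>\<^sub>M PiM {1..n} (\<lambda>_. borel)"
    unfolding observe_def split_beta'
    by (intro measurable_restrict borel_measurable_add borel_measurable_sum borel_measurable_times
          measurable_compose[OF measurable_fst measurable_vec_component]
          measurable_compose[OF measurable_snd measurable_compose[OF measurable_fst measurable_mat_component]]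
          measurable_compose[OF measurable_snd measurable_compose[OF measurable_snd measurable_vec_component]])
  then show ?thesis by (simp add: vec_space_def[of n])
qed

lemma product_sigma_finite_normal:
  assumes "\<sigma> > 0"
  shows "product_sigma_finite (\<lambda>_::nat. density lborel (normal_density 0 \<sigma>))"
proof -
  interpret prob_space "density lborel (normal_density 0 \<sigma>)" using assms by (rule prob_space_normal_density)
  show ?thesis by unfold_locales
qed

section \<open>Change of measure for a translated noise vector\<close>

text \<open>
  The coordinates are independent, so both sides are the product of the one-dimensional translated
  laws: a product measure is determined by its values on boxes.
\<close>
lemma distr_gauss_vec_shift:
  assumes "\<sigma> > 0"
  shows "distr (gauss_vec n \<sigma>) (vec_space n) (\<lambda>w. \<lambda>i\<in>{1..n}. v i + w i) =
         density (gauss_vec n \<sigma>) (\<lambda>w. \<Prod>i\<in>{1..n}. ennreal (shift_lr \<sigma> (v i) (w i)))"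
    (is "?shifted = ?tilted")
proof -
  let ?N = "density lborel (normal_density 0 \<sigma>)"
  interpret N: prob_space ?N using assms by (rule prob_space_normal_density)
  interpret P: product_sigma_finite "\<lambda>_::nat. ?N" by (rule product_sigma_finite_normal[OF assms])
  let ?Q = "\<lambda>i. density ?N (shift_lr \<sigma> (v i))"
  have Q: "?Q i = distr ?N borel (\<lambda>x. v i + x)" for i
    using distr_normal_shift[OF assms] by simp
  have probQ: "prob_space (?Q i)" for i
    unfolding Q by (rule N.prob_space_distr) simp
  interpret Q: product_sigma_finite ?Q
    using probQ prob_space_imp_sigma_finite unfolding product_sigma_finite_def by blast
  have shift[measurable]: "(\<lambda>w. \<lambda>i\<in>{1..n}. v i + w i) \<in> gauss_vec n \<sigma> \<rightarrow>\<^sub>M vec_space n"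
    unfolding vec_space_def gauss_vec_def by measurable
  have "?shifted = PiM {1..n} ?Q"
  proof (rule Q.PiM_eqI)
    fix A assume A: "\<And>i. i \<in> {1..n} \<Longrightarrow> A i \<in> sets (?Q i)"
    then have A': "\<And>i. i \<in> {1..n} \<Longrightarrow> A i \<in> sets borel" by simp
    have "(\<lambda>w. \<lambda>i\<in>{1..n}. v i + w i) -` Pi\<^sub>E {1..n} A \<inter> space (gauss_vec n \<sigma>) =
      (\<Pi>\<^sub>E i\<in>{1..n}. (\<lambda>x. v i + x) -` A i)"
      by (auto simp: gauss_vec_def space_PiM PiE_iff)
    moreover have "Pi\<^sub>E {1..n} A \<in> sets (vec_space n)"
      unfolding vec_space_def using A' by (intro sets_PiM_I_finite) auto
    ultimately have "emeasure ?shifted (Pi\<^sub>E {1..n} A) =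
      emeasure (gauss_vec n \<sigma>) (\<Pi>\<^sub>E i\<in>{1..n}. (\<lambda>x. v i + x) -` A i)"
      by (simp del: One_nat_def add: emeasure_distr[OF shift])
    also have "\<dots> = (\<Prod>i\<in>{1..n}. emeasure ?N ((\<lambda>x. v i + x) -` A i))"
      unfolding gauss_vec_def using A' by (subst P.emeasure_PiM) (auto intro!: measurable_sets_borel[of _ borel])
    also have "\<dots> = (\<Prod>i\<in>{1..n}. emeasure (?Q i) (A i))"
      using A' by (intro prod.cong refl) (simp add: Q emeasure_distr)
    finally show "emeasure ?shifted (Pi\<^sub>E {1..n} A) = (\<Prod>i\<in>{1..n}. emeasure (?Q i) (A i))" .
  qed (auto simp: vec_space_def intro!: sets_PiM_cong)
  also have "\<dots> = ?tilted"
  proof (rule Q.PiM_eqI[symmetric])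
    fix A assume A: "\<And>i. i \<in> {1..n} \<Longrightarrow> A i \<in> sets (?Q i)"
    then have A'[measurable]: "\<And>i. i \<in> {1..n} \<Longrightarrow> A i \<in> sets borel" by simp
    have [measurable]: "(\<lambda>w. \<Prod>i\<in>{1..n}. ennreal (shift_lr \<sigma> (v i) (w i))) \<in> borel_measurable (PiM {1..n} (\<lambda>_. ?N))"
      by (intro borel_measurable_prod_ennreal measurable_compose[OF measurable_component_singleton]) auto
    have "Pi\<^sub>E {1..n} A \<in> sets (PiM {1..n} (\<lambda>_. ?N))"
      using A' by (intro sets_PiM_I_finite) auto
    then have "emeasure ?tilted (Pi\<^sub>E {1..n} A) =
      (\<integral>\<^sup>+w. (\<Prod>i\<in>{1..n}. ennreal (shift_lr \<sigma> (v i) (w i))) * indicator (Pi\<^sub>E {1..n} A) w \<partial>PiM {1..n} (\<lambda>_. ?N))"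
      unfolding gauss_vec_def by (subst emeasure_density) auto
    also have "\<dots> = (\<integral>\<^sup>+w. (\<Prod>i\<in>{1..n}. ennreal (shift_lr \<sigma> (v i) (w i)) * indicator (A i) (w i)) \<partial>PiM {1..n} (\<lambda>_. ?N))"
      by (intro nn_integral_cong)
         (auto simp: prod.distrib space_PiM PiE_iff indicator_def prod_zero_iff split: if_splits)
    also have "\<dots> = (\<Prod>i\<in>{1..n}. \<integral>\<^sup>+x. ennreal (shift_lr \<sigma> (v i) x) * indicator (A i) x \<partial>?N)"
      by (rule P.product_nn_integral_prod) auto
    also have "\<dots> = (\<Prod>i\<in>{1..n}. emeasure (?Q i) (A i))"
      by (intro prod.cong refl) (simp add: emeasure_density)
    finally show "emeasure ?tilted (Pi\<^sub>E {1..n} A) = (\<Prod>i\<in>{1..n}. emeasure (?Q i) (A i))" .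
  qed (auto simp: gauss_vec_def intro!: sets_PiM_cong)
  finally show ?thesis .
qed


text \<open>
  With \<open>L\<close> the likelihood ratio, the left-hand side is the expectation of $L 1_A$. The
  elementary inequality $2 c L \le c^2 + L^2$ separates the event from the ratio and leaves only the
  second moment of \<open>L\<close>. The free parameter \<open>c\<close> balances the two terms; truncating
  at a level of \<open>L\<close> and using Markov's inequality would lose a factor of two and give
  nothing for two hypotheses.
\<close>
lemma emeasure_gauss_vec_shift_le:
  assumes \<sigma>: "\<sigma> > 0" and c: "c > 0" and A[measurable]: "A \<in> sets (vec_space n)"
  shows "emeasure (gauss_vec n \<sigma>) {w \<in> space (gauss_vec n \<sigma>). (\<lambda>i\<in>{1..n}. v i + w i) \<in> A} \<le>
    ennreal (c / 2) * emeasure (gauss_vec n \<sigma>) A + ennreal (exp ((\<Sum>i\<in>{1..n}. (v i)\<^sup>2) / \<sigma>\<^sup>2) / (2 * c))"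
proof -
  let ?G = "gauss_vec n \<sigma>" and ?N = "density lborel (normal_density 0 \<sigma>)"
  interpret P: product_sigma_finite "\<lambda>_::nat. ?N" by (rule product_sigma_finite_normal[OF \<sigma>])
  have shift[measurable]: "(\<lambda>w. \<lambda>i\<in>{1..n}. v i + w i) \<in> ?G \<rightarrow>\<^sub>M vec_space n"
    unfolding vec_space_def gauss_vec_def by measurable
  define L where "L w = (\<Prod>i\<in>{1..n}. shift_lr \<sigma> (v i) (w i))" for w
  have L_nonneg: "0 \<le> L w" for w
    by (simp add: L_def prod_nonneg)
  have comp[measurable]: "(\<lambda>w. w i) \<in> borel_measurable ?G" if "i \<in> {1..n}" for i
    using measurable_vec_component[OF that] by measurable
  have [measurable]: "(\<lambda>w. ennreal (L w)) \<in> borel_measurable ?G"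
    unfolding L_def by measurable
  have L_sq: "(\<integral>\<^sup>+w. ennreal ((L w)\<^sup>2) \<partial>?G) = ennreal (exp ((\<Sum>i\<in>{1..n}. (v i)\<^sup>2) / \<sigma>\<^sup>2))"
  proof -
    have "(\<integral>\<^sup>+w. ennreal ((L w)\<^sup>2) \<partial>?G) =
      (\<integral>\<^sup>+w. (\<Prod>i\<in>{1..n}. ennreal ((shift_lr \<sigma> (v i) (w i))\<^sup>2)) \<partial>PiM {1..n} (\<lambda>_. ?N))"
      unfolding gauss_vec_def by (simp add: L_def prod_power_distrib prod_ennreal)
    also have "\<dots> = (\<Prod>i\<in>{1..n}. \<integral>\<^sup>+x. ennreal ((shift_lr \<sigma> (v i) x)\<^sup>2) \<partial>?N)"
      by (rule P.product_nn_integral_prod) auto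
    also have "\<dots> = ennreal (\<Prod>i\<in>{1..n}. exp ((v i)\<^sup>2 / \<sigma>\<^sup>2))"
      by (simp add: nn_integral_shift_lr_sq[OF \<sigma>] prod_ennreal)
    also have "(\<Prod>i\<in>{1..n}. exp ((v i)\<^sup>2 / \<sigma>\<^sup>2)) = exp ((\<Sum>i\<in>{1..n}. (v i)\<^sup>2) / \<sigma>\<^sup>2)"
      by (simp add: exp_sum[symmetric] sum_divide_distrib)
    finally show ?thesis .
  qed
  have "{w \<in> space ?G. (\<lambda>i\<in>{1..n}. v i + w i) \<in> A} = (\<lambda>w. \<lambda>i\<in>{1..n}. v i + w i) -` A \<inter> space ?G"
    by auto
  then have "emeasure ?G {w \<in> space ?G. (\<lambda>i\<in>{1..n}. v i + w i) \<in> A} =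
    emeasure (distr ?G (vec_space n) (\<lambda>w. \<lambda>i\<in>{1..n}. v i + w i)) A"
    by (simp del: One_nat_def add: emeasure_distr[OF shift])
  also have "\<dots> = (\<integral>\<^sup>+w. ennreal (L w) * indicator A w \<partial>?G)"
    unfolding distr_gauss_vec_shift[OF \<sigma>]
    by (subst emeasure_density) (auto simp: L_def prod_ennreal)
  also have "\<dots> \<le> (\<integral>\<^sup>+w. ennreal (c / 2) * indicator A w + ennreal (1 / (2 * c)) * ennreal ((L w)\<^sup>2) \<partial>?G)"
  proof (intro nn_integral_mono)
    fix w
    have "0 \<le> (L w - c)\<^sup>2" by simp
    then have "L w \<le> c / 2 + 1 / (2 * c) * (L w)\<^sup>2"
      using c by (simp add: field_simps power2_eq_square)
    then have "ennreal (L w) \<le> ennreal (c / 2) + ennreal (1 / (2 * c)) * ennreal ((L w)\<^sup>2)"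
      using c by (simp add: ennreal_plus[symmetric] ennreal_mult[symmetric] del: ennreal_plus)
    then show "ennreal (L w) * indicator A w \<le>
        ennreal (c / 2) * indicator A w + ennreal (1 / (2 * c)) * ennreal ((L w)\<^sup>2)"
      by (auto split: split_indicator)
  qed
  also have "\<dots> = ennreal (c / 2) * emeasure ?G A +
      ennreal (1 / (2 * c)) * ennreal (exp ((\<Sum>i\<in>{1..n}. (v i)\<^sup>2) / \<sigma>\<^sup>2))"
    unfolding L_sq[symmetric] using L_nonneg
    by (subst nn_integral_add) (auto simp: nn_integral_cmult ennreal_power[symmetric])
  finally show ?thesis
    using c by (simp add: ennreal_mult[symmetric])
qed

section \<open>Adding one index to the support\<close>

lemma nn_integral_gauss_ensemble_entry_sq:
  assumes "i \<in> {1..n}" "j \<in> {1..p}"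
  shows "(\<integral>\<^sup>+X. ennreal ((X i j)\<^sup>2) \<partial>gauss_ensemble n p) = 1"
proof -
  let ?N = "density lborel (normal_density 0 1)"
  have entry: "(\<lambda>x. x j) \<in> gauss_vec p 1 \<rightarrow>\<^sub>M ?N"
    using measurable_vec_component[OF assms(2)] by measurable
  have row: "(\<lambda>X. X i) \<in> gauss_ensemble n p \<rightarrow>\<^sub>M gauss_vec p 1"
    unfolding gauss_ensemble_def using assms(1) by (rule measurable_component_singleton)
  have "(\<integral>\<^sup>+X. ennreal ((X i j)\<^sup>2) \<partial>gauss_ensemble n p) =
    (\<integral>\<^sup>+x. ennreal ((x j)\<^sup>2) \<partial>distr (gauss_ensemble n p) (gauss_vec p 1) (\<lambda>X. X i))"
    using entry by (subst nn_integral_distr[OF row]) auto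
  also have "distr (gauss_ensemble n p) (gauss_vec p 1) (\<lambda>X. X i) = gauss_vec p 1"
    unfolding gauss_ensemble_def
    by (rule distr_PiM_component[OF _ assms(1)]) (rule prob_space_gauss_vec, simp)
  also have "(\<integral>\<^sup>+x. ennreal ((x j)\<^sup>2) \<partial>gauss_vec p 1) =
    (\<integral>\<^sup>+y. ennreal (y\<^sup>2) \<partial>distr (gauss_vec p 1) ?N (\<lambda>x. x j))"
    by (subst nn_integral_distr[OF entry]) auto
  also have "distr (gauss_vec p 1) ?N (\<lambda>x. x j) = ?N"
    unfolding gauss_vec_def
    by (rule distr_PiM_component[OF _ assms(2)]) (rule prob_space_normal_density, simp)
  finally show ?thesis by (simp add: nn_integral_std_normal_sq)
qed

definition flat_signal :: "nat \<Rightarrow> real \<Rightarrow> nat set \<Rightarrow> nat \<Rightarrow> real" where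
  "flat_signal p m S = (\<lambda>i\<in>{1..p}. if i \<in> S then m else 0)"

lemma flat_signal_in_space: "flat_signal p m S \<in> space (vec_space p)"
  by (simp add: flat_signal_def vec_space_def space_PiM)

text \<open>
  The new column of the design enters only through $m X_j$, which can be counted as part of the
  noise.
\<close>
lemma observe_flat_signal_insert:
  assumes "j \<in> {1..p}" "j \<notin> T"
  shows "observe n p X (flat_signal p m (insert j T)) W =
    observe n p X (flat_signal p m T) (\<lambda>i\<in>{1..n}. m * X i j + W i)"
proof -
  have "(\<Sum>k\<in>{1..p}. X i k * flat_signal p m (insert j T) k) =
      (\<Sum>k\<in>{1..p}. X i k * flat_signal p m T k + (if k = j then m * X i j else 0))" for i
    using assms(2) by (intro sum.cong) (auto simp: flat_signal_def)
  also have "\<dots> i = (\<Sum>k\<in>{1..p}. X i k * flat_signal p m T k) + m * X i j" for i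
    using assms(1) by (simp add: sum.distrib)
  finally show ?thesis
    by (auto simp: observe_def restrict_def fun_eq_iff)
qed

definition design_noise :: "real \<Rightarrow> nat \<Rightarrow> nat \<Rightarrow> ((nat \<Rightarrow> nat \<Rightarrow> real) \<times> (nat \<Rightarrow> real)) measure" where
  "design_noise \<sigma> n p = gauss_ensemble n p \<Otimes>\<^sub>M gauss_vec n \<sigma>"

lemma prob_space_design_noise: "\<sigma> > 0 \<Longrightarrow> prob_space (design_noise \<sigma> n p)"
proof -
  assume "\<sigma> > 0"
  interpret X: prob_space "gauss_ensemble n p" by (rule prob_space_gauss_ensemble)
  interpret W: prob_space "gauss_vec n \<sigma>" using \<open>\<sigma> > 0\<close> by (rule prob_space_gauss_vec)
  interpret pair_prob_space "gauss_ensemble n p" "gauss_vec n \<sigma>" ..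
  show ?thesis unfolding design_noise_def by (rule P.prob_space_axioms)
qed

definition decodes_to ::
  "real \<Rightarrow> nat \<Rightarrow> nat \<Rightarrow> ((nat \<Rightarrow> nat \<Rightarrow> real) \<Rightarrow> (nat \<Rightarrow> real) \<Rightarrow> nat set)
    \<Rightarrow> (nat \<Rightarrow> real) \<Rightarrow> nat set \<Rightarrow> ((nat \<Rightarrow> nat \<Rightarrow> real) \<times> (nat \<Rightarrow> real)) set" where
  "decodes_to \<sigma> n p \<phi> \<beta> S =
     {(X, W) \<in> space (design_noise \<sigma> n p). \<phi> X (observe n p X \<beta> W) = S}"

lemma measurable_decode:
  assumes "decoder n p \<phi>"
  shows "(\<lambda>(\<beta>, X, W). \<phi> X (observe n p X \<beta> W)) \<in>
    vec_space p \<Otimes>\<^sub>M design_noise \<sigma> n p \<rightarrow>\<^sub>M count_space (Pow {1..p})"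
proof -
  have sets_eq: "sets (vec_space p \<Otimes>\<^sub>M design_noise \<sigma> n p) =
    sets (vec_space p \<Otimes>\<^sub>M (mat_space n p \<Otimes>\<^sub>M vec_space n))"
    unfolding design_noise_def
    by (intro sets_pair_measure_cong sets_gauss_ensemble sets_gauss_vec refl)
  have "(\<lambda>x. (fst (snd x), (\<lambda>(\<beta>, X, W). observe n p X \<beta> W) x)) \<in>
    vec_space p \<Otimes>\<^sub>M (mat_space n p \<Otimes>\<^sub>M vec_space n) \<rightarrow>\<^sub>M mat_space n p \<Otimes>\<^sub>M vec_space n"
    by (intro measurable_Pair measurable_observe) simp
  from measurable_compose[OF this assms[unfolded decoder_def]] show ?thesis
    by (simp add: measurable_cong_sets[OF sets_eq refl] split_beta')
qed

lemma sets_decodes_to: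
  assumes "decoder n p \<phi>" "\<beta> \<in> space (vec_space p)" "S \<subseteq> {1..p}"
  shows "decodes_to \<sigma> n p \<phi> \<beta> S \<in> sets (design_noise \<sigma> n p)"
proof -
  have "(\<lambda>x. (\<beta>, x)) \<in> design_noise \<sigma> n p \<rightarrow>\<^sub>M vec_space p \<Otimes>\<^sub>M design_noise \<sigma> n p"
    using assms(2) by (rule measurable_Pair1')
  from measurable_sets[OF measurable_compose[OF this measurable_decode[OF assms(1)]], of "{S}"] assms(3)
  have "(\<lambda>x. case (\<beta>, x) of (\<beta>, X, W) \<Rightarrow> \<phi> X (observe n p X \<beta> W)) -` {S} \<inter> space (design_noise \<sigma> n p)
    \<in> sets (design_noise \<sigma> n p)" by simp
  also have "(\<lambda>x. case (\<beta>, x) of (\<beta>, X, W) \<Rightarrow> \<phi> X (observe n p X \<beta> W)) -` {S} \<inter> space (design_noise \<sigma> n p)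
    = decodes_to \<sigma> n p \<phi> \<beta> S"
    by (auto simp: decodes_to_def)
  finally show ?thesis .
qed

text \<open>
  Given the design, the noise is translated by $m X_j$, so \<open>emeasure_gauss_vec_shift_le\<close>
  applies on each slice. Its last term is exponential in the squared length of $m X_j$ and need not
  be integrable over the design; it is therefore used only when that squared length is at most
  \<open>K\<close>. On the remaining slices the probability is at most one, hence at most the
  squared length divided by \<open>K\<close>, whose expectation is \<open>n * m\<^sup>2 / K\<close>.
\<close>
lemma decodes_to_flat_signal_insert_le:
  assumes \<sigma>: "\<sigma> > 0" and c: "c > 0" and K: "K > 0" and \<phi>: "decoder n p \<phi>"
    and S: "S \<subseteq> {1..p}" and j: "j \<in> {1..p}" "j \<notin> T"
  shows "measure (design_noise \<sigma> n p) (decodes_to \<sigma> n p \<phi> (flat_signal p m (insert j T)) S) \<le>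
    c / 2 * measure (design_noise \<sigma> n p) (decodes_to \<sigma> n p \<phi> (flat_signal p m T) S)
      + exp (K / \<sigma>\<^sup>2) / (2 * c) + real n * m\<^sup>2 / K"
proof -
  let ?X = "gauss_ensemble n p" and ?W = "gauss_vec n \<sigma>"
  let ?H = "\<lambda>T. decodes_to \<sigma> n p \<phi> (flat_signal p m T) S"
  interpret X: prob_space ?X by (rule prob_space_gauss_ensemble)
  interpret W: prob_space ?W using \<sigma> by (rule prob_space_gauss_vec)
  interpret XW: prob_space "design_noise \<sigma> n p" using \<sigma> by (rule prob_space_design_noise)
  have H[measurable]: "?H T \<in> sets (?X \<Otimes>\<^sub>M ?W)" for T
    using sets_decodes_to[OF \<phi> flat_signal_in_space S] by (simp add: design_noise_def)
  have [measurable]: "(\<lambda>X. X i j) \<in> borel_measurable ?X" if "i \<in> {1..n}" for i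
    using measurable_mat_component[OF that j(1)] by measurable
  have [measurable]: "(\<lambda>x. emeasure ?W (Pair x -` ?H T)) \<in> borel_measurable ?X" for T
    by (rule W.measurable_emeasure_Pair) (rule H)
  have fubini: "emeasure (design_noise \<sigma> n p) (?H T) = (\<integral>\<^sup>+x. emeasure ?W (Pair x -` ?H T) \<partial>?X)" for T
    unfolding design_noise_def by (rule W.emeasure_pair_measure_alt) (rule H)
  have energy_int: "(\<integral>\<^sup>+x. (\<Sum>i\<in>{1..n}. ennreal (m\<^sup>2 / K) * ennreal ((x i j)\<^sup>2)) \<partial>?X) =
    (\<Sum>i\<in>{1..n}. ennreal (m\<^sup>2 / K))"
    using nn_integral_gauss_ensemble_entry_sq[OF _ j(1)]
    by (subst nn_integral_sum) (auto simp: nn_integral_cmult intro!: sum.cong simp del: sum_constant One_nat_def)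
  have "emeasure (design_noise \<sigma> n p) (?H (insert j T)) \<le>
    (\<integral>\<^sup>+x. ennreal (c / 2) * emeasure ?W (Pair x -` ?H T) + ennreal (exp (K / \<sigma>\<^sup>2) / (2 * c))
      + (\<Sum>i\<in>{1..n}. ennreal (m\<^sup>2 / K) * ennreal ((x i j)\<^sup>2)) \<partial>?X)"
    unfolding fubini
  proof (intro nn_integral_mono)
    fix x assume x: "x \<in> space ?X"
    let ?E = "\<Sum>i\<in>{1..n}. (m * x i j)\<^sup>2"
    have slice: "Pair x -` ?H T \<in> sets ?W" for T
      using H by (rule sets_Pair1)
    have energy: "(\<Sum>i\<in>{1..n}. ennreal (m\<^sup>2 / K) * ennreal ((x i j)\<^sup>2)) = ennreal (?E / K)"
      using K by (simp add: ennreal_mult[symmetric] sum_divide_distrib power_mult_distrib)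
    have "(\<lambda>i\<in>{1..n}. m * x i j + w i) \<in> space ?W" for w
      by (simp add: gauss_vec_def space_PiM)
    then have "Pair x -` ?H (insert j T) =
      {w \<in> space ?W. (\<lambda>i\<in>{1..n}. m * x i j + w i) \<in> Pair x -` ?H T}"
      using x by (auto simp: decodes_to_def design_noise_def space_pair_measure
                             observe_flat_signal_insert[OF j])
    then have shifted: "emeasure ?W (Pair x -` ?H (insert j T)) \<le>
      ennreal (c / 2) * emeasure ?W (Pair x -` ?H T) + ennreal (exp (?E / \<sigma>\<^sup>2) / (2 * c))"
      using emeasure_gauss_vec_shift_le[OF \<sigma> c, of "Pair x -` ?H T" n "\<lambda>i. m * x i j"] slice
      by (simp add: sets_gauss_vec)
    show "emeasure ?W (Pair x -` ?H (insert j T)) \<le>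
      ennreal (c / 2) * emeasure ?W (Pair x -` ?H T) + ennreal (exp (K / \<sigma>\<^sup>2) / (2 * c))
      + (\<Sum>i\<in>{1..n}. ennreal (m\<^sup>2 / K) * ennreal ((x i j)\<^sup>2))"
    proof (cases "?E \<le> K")
      case True
      then have "ennreal (exp (?E / \<sigma>\<^sup>2) / (2 * c)) \<le> ennreal (exp (K / \<sigma>\<^sup>2) / (2 * c))"
        using c \<sigma> by (intro ennreal_leI divide_right_mono) (auto simp: divide_right_mono)
      with shifted show ?thesis
        by (meson add_left_mono add_increasing2 order_trans zero_le)
    next
      case False
      then have "1 \<le> ennreal (?E / K)" using K by simp
      then have "emeasure ?W (Pair x -` ?H (insert j T)) \<le> ennreal (?E / K)"
        using W.emeasure_le_1 order_trans by blast
      then show ?thesis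
        unfolding energy by (meson add_increasing zero_le)
    qed
  qed
  also have "\<dots> = ennreal (c / 2) * emeasure (design_noise \<sigma> n p) (?H T)
      + ennreal (exp (K / \<sigma>\<^sup>2) / (2 * c)) + (\<Sum>i\<in>{1..n}. ennreal (m\<^sup>2 / K))"
    using energy_int by (simp add: nn_integral_add nn_integral_cmult fubini X.emeasure_space_1)
  also have "\<dots> = ennreal (c / 2 * measure (design_noise \<sigma> n p) (?H T)
      + exp (K / \<sigma>\<^sup>2) / (2 * c) + real n * m\<^sup>2 / K)"
    using c K by (simp add: XW.emeasure_eq_measure ennreal_mult ennreal_of_nat_eq_real_of_nat
        ennreal_plus[symmetric] ennreal_mult[symmetric] del: ennreal_plus)
  finally show ?thesis
    using c K by (simp add: XW.emeasure_eq_measure del: ennreal_plus)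
qed

section \<open>Averaging over the supports\<close>

lemma finite_supports: "finite (supports p s)"
  by (rule finite_subset[of _ "Pow {1..p}"]) (auto simp: supports_def)

lemma card_supports: "card (supports p s) = p choose s"
  using n_subsets[of "{1..p}" s] by (simp add: supports_def)

text \<open>
  A set with a marked element is the same as the set without it and the element to be added. This is
  how the average over supports becomes an average over the side information \<open>T\<close> and
  the index to be located.
\<close>
lemma sum_supports_swap:
  fixes g :: "nat set \<Rightarrow> nat \<Rightarrow> 'a :: comm_monoid_add"
  assumes "s \<ge> 1"
  shows "(\<Sum>S\<in>supports p s. \<Sum>j\<in>S. g S j) =
    (\<Sum>T\<in>supports p (s - 1). \<Sum>j\<in>{1..p} - T. g (insert j T) j)"
proof -
  note fin = finite_supports
  have finS: "finite S" if "S \<in> supports p k" for S k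
    using that finite_subset[of S "{1..p}"] by (auto simp: supports_def)
  have "(\<Sum>S\<in>supports p s. \<Sum>j\<in>S. g S j) = (\<Sum>(S, j)\<in>(SIGMA S:supports p s. S). g S j)"
    using fin finS by (intro sum.Sigma) auto
  also have "\<dots> = (\<Sum>(T, j)\<in>(SIGMA T:supports p (s - 1). {1..p} - T). g (insert j T) j)"
  proof (rule sum.reindex_bij_witness[of _ "\<lambda>(T, j). (insert j T, j)" "\<lambda>(S, j). (S - {j}, j)"])
    fix b assume b: "b \<in> (SIGMA T:supports p (s - 1). {1..p} - T)"
    then obtain T j where "b = (T, j)" "T \<in> supports p (s - 1)" "j \<in> {1..p} - T" by auto
    moreover from this have "finite T" by (auto intro: finS)
    ultimately show "(case b of (T, j) \<Rightarrow> (insert j T, j)) \<in> (SIGMA S:supports p s. S)"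
      using assms by (auto simp: supports_def)
  qed (auto simp: supports_def insert_absorb)
  also have "\<dots> = (\<Sum>T\<in>supports p (s - 1). \<Sum>j\<in>{1..p} - T. g (insert j T) j)"
    using fin by (intro sum.Sigma[symmetric]) auto
  finally show ?thesis .
qed


lemma cond_error_flat_signal:
  assumes \<sigma>: "\<sigma> > 0" and \<phi>: "decoder n p \<phi>" and S: "S \<in> supports p s"
  shows "cond_error \<sigma> n p \<phi> (\<lambda>S. return (vec_space p) (flat_signal p m S)) S =
    1 - measure (design_noise \<sigma> n p) (decodes_to \<sigma> n p \<phi> (flat_signal p m S) S)"
proof -
  let ?D = "design_noise \<sigma> n p" and ?\<beta> = "flat_signal p m S"
  let ?J = "return (vec_space p) ?\<beta> \<Otimes>\<^sub>M ?D"
  let ?E = "{(\<beta>, X, W) \<in> space ?J. \<phi> X (observe n p X \<beta> W) \<noteq> S}"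
  interpret D: prob_space ?D using \<sigma> by (rule prob_space_design_noise)
  have "(\<lambda>(\<beta>, X, W). \<phi> X (observe n p X \<beta> W)) \<in> ?J \<rightarrow>\<^sub>M count_space (Pow {1..p})"
    using measurable_decode[OF \<phi>, of \<sigma>]
    by (simp add: measurable_cong_sets[OF sets_pair_measure_cong[OF sets_return refl] refl])
  from measurable_sets[OF this, of "Pow {1..p} - {S}"]
  have "(\<lambda>(\<beta>, X, W). \<phi> X (observe n p X \<beta> W)) -` (Pow {1..p} - {S}) \<inter> space ?J \<in> sets ?J"
    by simp
  also have "(\<lambda>(\<beta>, X, W). \<phi> X (observe n p X \<beta> W)) -` (Pow {1..p} - {S}) \<inter> space ?J = ?E"
    using measurable_space[OF \<open>(\<lambda>(\<beta>, X, W). \<phi> X (observe n p X \<beta> W)) \<in> ?J \<rightarrow>\<^sub>M count_space (Pow {1..p})\<close>]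
    by fastforce
  finally have E: "?E \<in> sets ?J" .
  have H: "decodes_to \<sigma> n p \<phi> ?\<beta> S \<in> sets ?D"
    using S by (intro sets_decodes_to \<phi> flat_signal_in_space) (auto simp: supports_def)
  have "(\<lambda>x. emeasure ?D (Pair x -` ?E)) \<in> borel_measurable (return (vec_space p) ?\<beta>)"
    using E by (rule D.measurable_emeasure_Pair)
  then have "emeasure ?J ?E = emeasure ?D (Pair ?\<beta> -` ?E)"
    by (subst D.emeasure_pair_measure_alt[OF E])
       (auto intro!: nn_integral_return flat_signal_in_space)
  also have "Pair ?\<beta> -` ?E = space ?D - decodes_to \<sigma> n p \<phi> ?\<beta> S"
    using flat_signal_in_space[of p m S] by (auto simp: decodes_to_def space_pair_measure)
  finally have "measure ?J ?E = measure ?D (space ?D - decodes_to \<sigma> n p \<phi> ?\<beta> S)"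
    by (simp add: measure_def)
  then show ?thesis
    using D.prob_compl[OF H] by (simp add: cond_error_def joint_law_def design_noise_def)
qed

lemma admissible_flat_signal:
  assumes "1 \<le> s" "m > 0"
  shows "admissible p s m (\<lambda>S. return (vec_space p) (flat_signal p m S))"
  unfolding admissible_def
proof (intro ballI conjI)
  fix S assume S: "S \<in> supports p s"
  let ?\<beta> = "flat_signal p m S"
  show "prob_space (return (vec_space p) ?\<beta>)"
    by (rule prob_space_return[OF flat_signal_in_space])
  show "sets (return (vec_space p) ?\<beta>) = sets (vec_space p)" by simp
  have supp: "supp p ?\<beta> = S"
    using S assms by (auto simp: supp_def flat_signal_def supports_def)
  have "S \<noteq> {}" using S assms by (auto simp: supports_def)
  moreover have "\<bar>?\<beta> i\<bar> = m" if "i \<in> S" for i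
    using S assms that by (auto simp: flat_signal_def supports_def)
  ultimately have "(\<lambda>i. \<bar>?\<beta> i\<bar>) ` S = {m}" by auto
  then have min: "min_value p ?\<beta> = m" by (simp add: min_value_def supp)
  have "AE \<beta> in return (vec_space p) ?\<beta>. \<forall>i\<in>{1..p}. \<beta> i = ?\<beta> i"
  proof (subst AE_return)
    show "Measurable.pred (vec_space p) (\<lambda>\<beta>. \<forall>i\<in>{1..p}. \<beta> i = ?\<beta> i)"
      using measurable_vec_component by measurable
  qed (auto intro: flat_signal_in_space)
  then show "AE \<beta> in return (vec_space p) ?\<beta>. supp p \<beta> = S \<and> min_value p \<beta> = m"
  proof eventually_elim
    case (elim \<beta>)
    then have *: "supp p \<beta> = supp p ?\<beta>" by (auto simp: supp_def)
    moreover have "(\<lambda>i. \<bar>\<beta> i\<bar>) ` supp p ?\<beta> = (\<lambda>i. \<bar>?\<beta> i\<bar>) ` supp p ?\<beta>"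
      using elim by (intro image_cong) (auto simp: supp_def)
    ultimately show ?case using supp min by (simp add: min_value_def)
  qed
qed

text \<open>A decoder gives one answer, so the events of distinct answers are disjoint.\<close>
lemma sum_decodes_to_le_1:
  assumes \<sigma>: "\<sigma> > 0" and \<phi>: "decoder n p \<phi>" and \<beta>: "\<beta> \<in> space (vec_space p)"
    and I: "finite I" "inj_on f I" "\<And>i. i \<in> I \<Longrightarrow> f i \<subseteq> {1..p}"
  shows "(\<Sum>i\<in>I. measure (design_noise \<sigma> n p) (decodes_to \<sigma> n p \<phi> \<beta> (f i))) \<le> 1"
proof -
  interpret D: prob_space "design_noise \<sigma> n p" using \<sigma> by (rule prob_space_design_noise)
  have "(\<Sum>i\<in>I. measure (design_noise \<sigma> n p) (decodes_to \<sigma> n p \<phi> \<beta> (f i))) =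
    measure (design_noise \<sigma> n p) (\<Union>i\<in>I. decodes_to \<sigma> n p \<phi> \<beta> (f i))"
    using I sets_decodes_to[OF \<phi> \<beta>]
    by (intro D.finite_measure_finite_Union[symmetric])
       (auto simp: disjoint_family_on_def decodes_to_def inj_on_def)
  then show ?thesis by simp
qed

text \<open>
  The success probabilities on the supports $T \cup \{j\}$ are compared with the probabilities of the
  same answers under the signal on \<open>T\<close>. For each \<open>T\<close> the latter sum to at most
  one over \<open>p - s + 1\<close> indices, so the factor \<open>c / 2\<close> is divided by that number
  on average.
\<close>
lemma p_err_flat_signal_ge:
  assumes \<sigma>: "\<sigma> > 0" and \<phi>: "decoder n p \<phi>" and s: "1 \<le> s" "s \<le> p" and c: "c > 0" and K: "K > 0"
  shows "p_err \<sigma> n p s \<phi> (\<lambda>S. return (vec_space p) (flat_signal p m S)) \<ge>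
    1 - (c / (2 * real (p - s + 1)) + exp (K / \<sigma>\<^sup>2) / (2 * c) + real n * m\<^sup>2 / K)"
proof -
  define P where "P T S = measure (design_noise \<sigma> n p) (decodes_to \<sigma> n p \<phi> (flat_signal p m T) S)" for T S
  define \<delta> where "\<delta> = exp (K / \<sigma>\<^sup>2) / (2 * c) + real n * m\<^sup>2 / K"
  define N where "N = p - s + 1"
  have N: "N > 0" by (simp add: N_def)
  have T: "finite T" "card ({1..p} - T) = N" if "T \<in> supports p (s - 1)" for T
    using that s finite_subset[of T "{1..p}"] by (auto simp: supports_def N_def card_Diff_subset)
  (* The number of pairs counted in both ways: the case of a constant summand. *)
  have pairs: "s * (p choose s) = N * (p choose (s - 1))"
  proof -
    have "(\<Sum>S\<in>supports p s. \<Sum>j\<in>S. 1) = (\<Sum>T\<in>supports p (s - 1). \<Sum>j\<in>{1..p} - T. 1 :: nat)"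
      using s(1) by (rule sum_supports_swap)
    moreover have "(\<Sum>S\<in>supports p s. \<Sum>j\<in>S. 1) = (\<Sum>S\<in>supports p s. s)"
      by (intro sum.cong) (auto simp: supports_def)
    moreover have "(\<Sum>T\<in>supports p (s - 1). \<Sum>j\<in>{1..p} - T. 1) = (\<Sum>T\<in>supports p (s - 1). N)"
      using T by (intro sum.cong) auto
    ultimately show ?thesis by (simp add: card_supports mult.commute)
  qed
  have "real s * (\<Sum>S\<in>supports p s. P S S) = (\<Sum>S\<in>supports p s. \<Sum>j\<in>S. P S S)"
    unfolding sum_distrib_left by (intro sum.cong) (auto simp: supports_def)
  also have "\<dots> = (\<Sum>T\<in>supports p (s - 1). \<Sum>j\<in>{1..p} - T. P (insert j T) (insert j T))"
    using s(1) by (rule sum_supports_swap)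
  also have "\<dots> \<le> (\<Sum>T\<in>supports p (s - 1). \<Sum>j\<in>{1..p} - T. c / 2 * P T (insert j T) + \<delta>)"
  proof (intro sum_mono)
    fix T j assume "T \<in> supports p (s - 1)" "j \<in> {1..p} - T"
    then show "P (insert j T) (insert j T) \<le> c / 2 * P T (insert j T) + \<delta>"
      using decodes_to_flat_signal_insert_le[OF \<sigma> c K \<phi>, of "insert j T" j T m]
      by (auto simp: P_def \<delta>_def supports_def)
  qed
  also have "\<dots> \<le> (\<Sum>T\<in>supports p (s - 1). c / 2 + real N * \<delta>)"
  proof (intro sum_mono)
    fix T assume T': "T \<in> supports p (s - 1)"
    have "(\<Sum>j\<in>{1..p} - T. P T (insert j T)) \<le> 1"
      unfolding P_def using T'
      by (intro sum_decodes_to_le_1[OF \<sigma> \<phi> flat_signal_in_space]) (auto simp: inj_on_def supports_def)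
    then have "c / 2 * (\<Sum>j\<in>{1..p} - T. P T (insert j T)) \<le> c / 2 * 1"
      using c by (intro mult_left_mono) auto
    then show "(\<Sum>j\<in>{1..p} - T. c / 2 * P T (insert j T) + \<delta>) \<le> c / 2 + real N * \<delta>"
      using T[OF T'] by (simp add: sum.distrib sum_distrib_left)
  qed
  also have "\<dots> = real (N * (p choose (s - 1))) * (c / (2 * real N) + \<delta>)"
    using N by (simp add: card_supports field_simps)
  finally have "(\<Sum>S\<in>supports p s. P S S) \<le> real (p choose s) * (c / (2 * real N) + \<delta>)"
    using s(1) unfolding pairs[symmetric] by (simp add: mult.assoc)
  then have "(\<Sum>S\<in>supports p s. P S S) / real (p choose s) \<le> c / (2 * real N) + \<delta>"
    using s(2) by (simp add: pos_divide_le_eq mult.commute)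
  moreover have "p_err \<sigma> n p s \<phi> (\<lambda>S. return (vec_space p) (flat_signal p m S)) =
    1 / real (p choose s) * (\<Sum>S\<in>supports p s. 1 - P S S)"
    unfolding p_err_def P_def
    by (intro arg_cong2[where f="(*)"] sum.cong refl cond_error_flat_signal[OF \<sigma> \<phi>])
  ultimately show ?thesis
    using s(2) by (simp add: sum_subtractf card_supports right_diff_distrib \<delta>_def N_def)
qed

section \<open>Failure of recovery below the threshold\<close>

text \<open>
  With $x = N^{1/4}$ the free parameters are $c = x^2$ and the $K$ with $\exp(K / \sigma^2) = x$.
  Then \<open>c\<close> grows more slowly than \<open>N\<close>, and $\exp(K / \sigma^2)$ more slowly than
  \<open>c\<close>, while \<open>K\<close> is still of order
  $\sigma^2 \log N$, as the Markov term requires. The hypothesis on \<open>n\<close> forces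
  \<open>s < p\<close>, so $N \ge 2$, which is what keeps the bound away from the trivial one.
\<close>
lemma p_err_flat_signal_ge_const:
  assumes \<sigma>: "\<sigma> > 0" and \<phi>: "decoder n p \<phi>" and s: "1 \<le> s" "s \<le> p" and m: "m > 0" and n: "n \<ge> 1"
    and few: "real n < (\<sigma>\<^sup>2 / 40 / (real s * m\<^sup>2)) * (real s * ln (real p / real s))"
  shows "p_err \<sigma> n p s \<phi> (\<lambda>S. return (vec_space p) (flat_signal p m S)) \<ge> 1 / 20"
proof -
  have energy: "real n * m\<^sup>2 < \<sigma>\<^sup>2 / 40 * ln (real p / real s)"
    using few m s by (simp add: field_simps)
  have "0 < real n * m\<^sup>2" using n m by simp
  with energy have "0 < \<sigma>\<^sup>2 / 40 * ln (real p / real s)" by linarith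
  then have "0 < ln (real p / real s)" using \<sigma> by (simp add: zero_less_mult_iff)
  then have ps: "s < p" using s by (simp add: ln_gt_zero_iff)
  define N where "N = real (p - s + 1)"
  have N2: "N \<ge> 2" using ps by (simp add: N_def)
  have "real p \<le> real s * N"
  proof -
    (* This product is exactly the difference s * N - p. *)
    have "0 \<le> (real s - 1) * (real p - real s)" using s by simp
    then show ?thesis using s by (simp add: N_def of_nat_diff algebra_simps)
  qed
  then have "ln (real p / real s) \<le> ln N"
    using s N2 by (intro ln_mono) (auto simp: field_simps)
  then have energy: "real n * m\<^sup>2 \<le> \<sigma>\<^sup>2 / 40 * ln N"
    using energy \<sigma> by (meson less_imp_le mult_left_mono order_trans zero_le_divide_iff zero_le_numeral zero_le_power2)
  define x where "x = exp (ln N / 4)"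
  define K where "K = \<sigma>\<^sup>2 * ln N / 4"
  have lnN: "ln N > 0" using N2 by simp
  have K: "K > 0" using lnN \<sigma> by (simp add: K_def)
  have x4: "x ^ 4 = N"
    using N2 by (simp add: x_def exp_of_nat_mult[symmetric])
  (* 1.18 is a rational lower bound for the fourth root of 2. *)
  have x: "x \<ge> 118 / 100"
  proof (rule ccontr)
    assume "\<not> x \<ge> 118 / 100"
    then have "x ^ 4 \<le> (118 / 100) ^ 4" by (intro power_mono) (auto simp: x_def)
    with x4 N2 show False by (simp add: power_divide)
  qed
  have "x\<^sup>2 / (2 * N) + exp (K / \<sigma>\<^sup>2) / (2 * x\<^sup>2) = (1 / x\<^sup>2 + 1 / x) / 2"
  proof -
    have "exp (K / \<sigma>\<^sup>2) = x" using \<sigma> by (simp add: K_def x_def)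
    then show ?thesis
      using x unfolding x4[symmetric] by (simp add: field_simps power2_eq_square power4_eq_xxxx)
  qed
  also have "\<dots> \<le> 1 / x"
    using x by (simp add: field_simps power2_eq_square)
  also have "\<dots> \<le> 100 / 118"
    using x by (simp add: field_simps)
  finally have "x\<^sup>2 / (2 * N) + exp (K / \<sigma>\<^sup>2) / (2 * x\<^sup>2) \<le> 100 / 118" .
  moreover have "real n * m\<^sup>2 / K \<le> 1 / 10"
    using energy K by (simp add: pos_divide_le_eq K_def)
  moreover have "p_err \<sigma> n p s \<phi> (\<lambda>S. return (vec_space p) (flat_signal p m S)) \<ge>
    1 - (x\<^sup>2 / (2 * N) + exp (K / \<sigma>\<^sup>2) / (2 * x\<^sup>2) + real n * m\<^sup>2 / K)"
    unfolding N_def using x by (intro p_err_flat_signal_ge[OF \<sigma> \<phi> s _ K]) auto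
  ultimately show ?thesis by linarith
qed

theorem theorem2:
  fixes \<sigma> :: real
  assumes "\<sigma> > 0"
  shows "\<exists>C'>0. \<forall>(p :: nat \<Rightarrow> nat) (s :: nat \<Rightarrow> nat) (m :: nat \<Rightarrow> real).
           (\<forall>n\<ge>1. 1 \<le> s n \<and> s n \<le> p n \<and> m n > 0) \<longrightarrow>
           (\<forall>\<^sub>F n in sequentially.
              real n < (C' / (real (s n) * (m n)\<^sup>2)) * (real (s n) * ln (real (p n) / real (s n)))) \<longrightarrow>
           \<not> reliable_recovery_possible \<sigma> p s m"
proof (intro exI[of _ "\<sigma>\<^sup>2 / 40"] conjI allI impI notI)
  show "\<sigma>\<^sup>2 / 40 > 0" using assms by simp
next
  fix p s :: "nat \<Rightarrow> nat" and m :: "nat \<Rightarrow> real"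
  assume params: "\<forall>n\<ge>1. 1 \<le> s n \<and> s n \<le> p n \<and> m n > 0"
    and few: "\<forall>\<^sub>F n in sequentially.
      real n < (\<sigma>\<^sup>2 / 40 / (real (s n) * (m n)\<^sup>2)) * (real (s n) * ln (real (p n) / real (s n)))"
    and "reliable_recovery_possible \<sigma> p s m"
  then obtain \<phi> where \<phi>: "\<And>n. n \<ge> 1 \<Longrightarrow> decoder n (p n) (\<phi> n)"
    and reliable: "\<And>Q. (\<forall>n\<ge>1. admissible (p n) (s n) (m n) (Q n)) \<Longrightarrow>
      (\<lambda>n. p_err \<sigma> n (p n) (s n) (\<phi> n) (Q n)) \<longlonglongrightarrow> 0"
    unfolding reliable_recovery_possible_def by blast
  let ?Q = "\<lambda>n S. return (vec_space (p n)) (flat_signal (p n) (m n) S)"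
  have "(\<lambda>n. p_err \<sigma> n (p n) (s n) (\<phi> n) (?Q n)) \<longlonglongrightarrow> 0"
    using params by (intro reliable allI impI admissible_flat_signal) auto
  then have "\<forall>\<^sub>F n in sequentially. p_err \<sigma> n (p n) (s n) (\<phi> n) (?Q n) < 1 / 20"
    by (rule order_tendstoD(2)) simp
  with few eventually_ge_at_top[of 1] have "\<forall>\<^sub>F n in sequentially. False"
  proof eventually_elim
    case (elim n)
    then show False
      using p_err_flat_signal_ge_const[OF assms \<phi>, of n "s n" "m n"] params by fastforce
  qed
  then show False by simp
qed

end
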